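(* Suppose that $f:\mathbb{C}^*\to\mathbb{C}^*$ is a transcendental analytic self-map of the punctured plane $\mathbb{C}^*=\mathbb{C}\setminus\{0\}$. Then the classical Julia set of $f$ (the complement in $\mathbb{C}^*$ of the set of points having a neighbourhood in which the family of iterates of $f$ is normal) is equal to the set of all points $z\in\mathbb{C}^*$ such that, for every neighbourhood $U\subset\mathbb{C}^*$ of $z$, the set $\widehat{\mathbb{C}}\setminus O^+(U)$ is finite, where $O^+(U)=\bigcup_{k\in\mathbb{N}}f^k(U)$.
   Context: Here $\widehat{\mathbb{C}}=\mathbb{C}\cup\{\infty\}$, $\mathbb{N}=\{1,2,\ldots\}$ and $f^k$ denotes the $k$-th iterate. A transcendental analytic self-map of $\mathbb{C}^*$ is an analytic map $f:\mathbb{C}^*\to\mathbb{C}^*$ for which both $0$ and $\infty$ are essential singularities. The classical Fatou set is the set of points of $\mathbb{C}^*$ that have a neighbourhood in which $\{f^k\}_{k\in\mathbb{N}}$ is a normal family (as maps into $\widehat{\mathbb{C}}$ with the spherical metric); the classical Julia set is its complement in $\mathbb{C}^*$. *)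

theory Defs
  imports "HOL-Complex_Analysis.Complex_Analysis"
begin

text \<open>The Riemann sphere as a set: \<open>Some z\<close> is the finite point \<open>z\<close> and \<open>None\<close> is infinity.\<close>

type_synonym riemann_sphere = "complex option"

text \<open>Inverse stereographic projection onto the unit sphere of \<open>complex \<times> real\<close>, with
  infinity going to the north pole; the spherical metric is the great-circle distance of the images.\<close>

definition stereo :: "riemann_sphere \<Rightarrow> complex \<times> real" where
  "stereo p = (case p of
      None \<Rightarrow> (0, 1)
    | Some z \<Rightarrow> ((2 / (1 + (cmod z)\<^sup>2)) *\<^sub>R z, ((cmod z)\<^sup>2 - 1) / ((cmod z)\<^sup>2 + 1)))"

definition spherical_dist :: "riemann_sphere \<Rightarrow> riemann_sphere \<Rightarrow> real" where
  "spherical_dist p q = arccos (stereo p \<bullet> stereo q)"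

text \<open>Normality on an open set \<open>U\<close>: every sequence in the family has a subsequence converging
  uniformly on compact subsets of \<open>U\<close> in the spherical metric. The limit \<open>g\<close> may take the value
  infinity. Values of the maps outside \<open>U\<close> are irrelevant.\<close>

definition normal_family_on :: "complex set \<Rightarrow> (complex \<Rightarrow> riemann_sphere) set \<Rightarrow> bool" where
  "normal_family_on U F \<longleftrightarrow>
     (\<forall>s :: nat \<Rightarrow> complex \<Rightarrow> riemann_sphere. range s \<subseteq> F \<longrightarrow>
        (\<exists>r :: nat \<Rightarrow> nat. strict_mono r \<and>
          (\<exists>g :: complex \<Rightarrow> riemann_sphere. \<forall>K. compact K \<and> K \<subseteq> U \<longrightarrow>
             uniform_limit K (\<lambda>n z. spherical_dist (s (r n) z) (g z)) (\<lambda>_. 0) sequentially)))"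

definition punctured_plane :: "complex set" where
  "punctured_plane = UNIV - {0}"

definition essential_singularity_at :: "(complex \<Rightarrow> complex) \<Rightarrow> complex \<Rightarrow> bool" where
  "essential_singularity_at f z \<longleftrightarrow> isolated_singularity_at f z \<and> \<not> not_essential f z"

text \<open>Self-maps of the punctured plane are total functions whose value at 0 plays no role.
  The singularity at infinity is that of \<open>\<lambda>w. f (1 / w)\<close> at 0.\<close>

definition transcendental_self_map :: "(complex \<Rightarrow> complex) \<Rightarrow> bool" where
  "transcendental_self_map f \<longleftrightarrow>
     f holomorphic_on punctured_plane \<and>
     f ` punctured_plane \<subseteq> punctured_plane \<and>
     essential_singularity_at f 0 \<and>
     essential_singularity_at (\<lambda>w. f (1 / w)) 0"

definition fatou_set :: "(complex \<Rightarrow> complex) \<Rightarrow> complex set" where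
  "fatou_set f = {z \<in> punctured_plane. \<exists>U. open U \<and> z \<in> U \<and> U \<subseteq> punctured_plane \<and>
     normal_family_on U {(\<lambda>w. Some ((f ^^ k) w)) | k. k \<ge> 1}}"

definition julia_set :: "(complex \<Rightarrow> complex) \<Rightarrow> complex set" where
  "julia_set f = punctured_plane - fatou_set f"

definition forward_orbit :: "(complex \<Rightarrow> complex) \<Rightarrow> complex set \<Rightarrow> complex set" where
  "forward_orbit f U = (\<Union>k\<in>{1..}. (f ^^ k) ` U)"

end

(* If U is an open set whose forward orbit omits some a in the punctured plane, then the iterates
   omit 0, a and infinity on U, so they are normal there by Montel's test; hence points of the
   Julia set satisfy the covering condition. Conversely the Fatou set is forward invariant, so the
   forward orbit of a small neighbourhood of a Fatou point misses the Julia set, and it is enough to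
   know that the Julia set is infinite. By the great Picard theorem every point of the punctured
   plane has infinitely many preimages, so a non-empty Julia set is infinite.

   Suppose the Julia set were empty. Picard applied to f(z)/z yields infinitely many fixed points;
   boundedness of the iterates at one of them propagates to local boundedness on the whole punctured
   plane. A limit g of a subsequence fixes the fixed points of f, hence is not constant, and by
   Hurwitz it has no zero. If n_j is the subsequence, a limit h of f^(n_{j+1} - n_j) satisfies
   h o g = g, so h is the identity by the identity theorem. Then f would be injective, against
   Picard. *)

theory Submission
  imports Defs
begin

section \<open>The spherical metric through stereographic coordinates\<close>

lemma inner_stereo_self: "stereo p \<bullet> stereo p = 1"
proof (cases p)
  case None
  then show ?thesis by (simp add: stereo_def)
next
  case (Some z)
  define Z where "Z = (cmod z)\<^sup>2"
  have Z: "Z \<ge> 0" by (simp add: Z_def)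
  have "stereo p \<bullet> stereo p = (2 / (1 + Z))\<^sup>2 * Z + ((Z - 1) / (Z + 1))\<^sup>2"
    unfolding inner_prod_def
    by (simp add: Some stereo_def Z_def dot_square_norm) (simp add: power2_eq_square)
  also have "\<dots> = (4 * Z + (Z - 1)\<^sup>2) / (1 + Z)\<^sup>2"
    using Z by (simp add: power_divide add_divide_distrib add.commute)
  also have "4 * Z + (Z - 1)\<^sup>2 = (1 + Z)\<^sup>2"
    by (simp add: power2_eq_square algebra_simps)
  finally show ?thesis using Z by simp
qed

lemma norm_stereo [simp]: "norm (stereo p) = 1"
  by (simp add: norm_eq_sqrt_inner inner_stereo_self)

lemma inner_stereo_bounds: "\<bar>stereo p \<bullet> stereo q\<bar> \<le> 1"
  using Cauchy_Schwarz_ineq2[of "stereo p" "stereo q"] by simp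

lemma dist_stereo_sq: "(dist (stereo p) (stereo q))\<^sup>2 = 2 - 2 * (stereo p \<bullet> stereo q)"
  by (simp add: dist_norm power2_norm_eq_inner inner_diff_left inner_diff_right
      inner_stereo_self inner_commute)

lemma spherical_dist_nonneg: "0 \<le> spherical_dist p q"
  unfolding spherical_dist_def using inner_stereo_bounds[of p q] by (intro arccos_lbound) auto

text \<open>A chord is no longer than its arc: with arc length \<open>d\<close> the chord is
  \<open>2 * sin (d / 2)\<close>. This turns spherical convergence into uniform convergence of maps
  into Euclidean space.\<close>

lemma dist_stereo_le: "dist (stereo p) (stereo q) \<le> spherical_dist p q"
proof (rule power2_le_imp_le)
  define d where "d = spherical_dist p q"
  have "stereo p \<bullet> stereo q = cos d"
    unfolding d_def spherical_dist_def using inner_stereo_bounds[of p q] by auto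
  then have "(dist (stereo p) (stereo q))\<^sup>2 = 4 * (sin (d / 2))\<^sup>2"
    using cos_double_sin[of "d / 2"] by (simp add: dist_stereo_sq)
  also have "\<dots> \<le> 4 * (d / 2)\<^sup>2"
    using abs_sin_x_le_abs_x[of "d / 2"] by (intro mult_left_mono) (auto simp flip: abs_le_square_iff)
  finally show "(dist (stereo p) (stereo q))\<^sup>2 \<le> (spherical_dist p q)\<^sup>2"
    by (simp add: d_def power2_eq_square)
qed (rule spherical_dist_nonneg)

text \<open>The left side is half the squared chordal distance and equals
  \<open>2 * |z - w|^2 / ((1 + |z|^2) * (1 + |w|^2))\<close>, whose denominator is at least
  1.\<close>

lemma one_minus_inner_stereo_le: "1 - stereo (Some z) \<bullet> stereo (Some w) \<le> 2 * (dist z w)\<^sup>2"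
proof -
  define Z W where "Z = (cmod z)\<^sup>2" and "W = (cmod w)\<^sup>2"
  have Z: "Z \<ge> 0" "W \<ge> 0" by (simp_all add: Z_def W_def)
  have d: "(dist z w)\<^sup>2 = Z + W - 2 * (z \<bullet> w)"
    by (simp add: dist_norm power2_norm_eq_inner inner_diff_left inner_diff_right Z_def W_def
      inner_commute)
  have "stereo (Some z) \<bullet> stereo (Some w) =
     (4 * (z \<bullet> w) + (Z - 1) * (W - 1)) / ((1 + Z) * (1 + W))"
    by (simp add: stereo_def Z_def W_def add_divide_distrib add.commute)
  then have "1 - stereo (Some z) \<bullet> stereo (Some w) = 2 * (dist z w)\<^sup>2 / ((1 + Z) * (1 + W))"
  proof -
    have "(1 + Z) * (1 + W) \<noteq> 0" using Z by (simp add: add_nonneg_eq_0_iff)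
    then have "1 - (4 * (z \<bullet> w) + (Z - 1) * (W - 1)) / ((1 + Z) * (1 + W)) =
      ((1 + Z) * (1 + W) - (4 * (z \<bullet> w) + (Z - 1) * (W - 1))) / ((1 + Z) * (1 + W))"
      by (simp add: diff_divide_distrib)
    moreover have "(1 + Z) * (1 + W) - (4 * (z \<bullet> w) + (Z - 1) * (W - 1)) = 2 * (dist z w)\<^sup>2"
      unfolding d by (simp add: algebra_simps)
    ultimately show ?thesis
      using \<open>stereo (Some z) \<bullet> stereo (Some w) = _\<close> by simp
  qed
  also have "\<dots> \<le> 2 * (dist z w)\<^sup>2 / 1"
    using mult_mono[of 1 "1 + Z" 1 "1 + W"] Z by (intro divide_left_mono) auto
  finally show ?thesis by simp
qed

lemma uniform_limit_spherical_dist: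
  assumes "uniform_limit K h g sequentially"
  shows "uniform_limit K (\<lambda>n z. spherical_dist (Some (h n z)) (Some (g z))) (\<lambda>_. 0) sequentially"
proof (rule uniform_limitI)
  fix e :: real assume "e > 0"
  \<comment> \<open>Capping at \<open>pi\<close> keeps \<open>d\<close> in the range where
    \<open>arccos (cos d) = d\<close>.\<close>
  define d where "d = min e pi"
  have d: "0 < d" "d \<le> pi" "d \<le> e" using \<open>e > 0\<close> by (auto simp: d_def)
  have c: "cos d < 1" using cos_monotone_0_pi[of 0 d] d by simp
  \<comment> \<open>Chosen so that \<open>2 * \<eta>^2 = 1 - cos d\<close>; Euclidean distance below
    \<open>\<eta>\<close> then forces the inner product above \<open>cos d\<close>.\<close>
  define \<eta> where "\<eta> = sqrt ((1 - cos d) / 2)"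
  have "\<eta> > 0" using c by (simp add: \<eta>_def)
  with assms have "\<forall>\<^sub>F n in sequentially. \<forall>z\<in>K. dist (h n z) (g z) < \<eta>"
    by (rule uniform_limitD)
  then show "\<forall>\<^sub>F n in sequentially. \<forall>z\<in>K. dist (spherical_dist (Some (h n z)) (Some (g z))) 0 < e"
  proof (eventually_elim, intro ballI)
    fix n z assume *: "\<forall>z\<in>K. dist (h n z) (g z) < \<eta>" "z \<in> K"
    let ?c = "stereo (Some (h n z)) \<bullet> stereo (Some (g z))"
    have "(dist (h n z) (g z))\<^sup>2 < \<eta>\<^sup>2"
      using * by (intro power_strict_mono) auto
    also have "\<eta>\<^sup>2 = (1 - cos d) / 2" using c by (simp add: \<eta>_def)
    finally have "cos d < ?c"
      using one_minus_inner_stereo_le[of "h n z" "g z"] by simp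
    then have "arccos ?c < arccos (cos d)"
      using inner_stereo_bounds[of "Some (h n z)" "Some (g z)"] by (intro arccos_less_arccos) auto
    then have "spherical_dist (Some (h n z)) (Some (g z)) < e"
      using d by (simp add: arccos_cos spherical_dist_def)
    then show "dist (spherical_dist (Some (h n z)) (Some (g z))) 0 < e"
      by (simp add: spherical_dist_nonneg)
  qed
qed

definition sphere_inverse :: "riemann_sphere \<Rightarrow> riemann_sphere" where
  "sphere_inverse p =
     (case p of None \<Rightarrow> Some 0 | Some z \<Rightarrow> if z = 0 then None else Some (inverse z))"

text \<open>Inversion extended to the sphere is the half-turn about the real axis, hence an
  isometry.\<close>

lemma stereo_sphere_inverse:
  "stereo (sphere_inverse p) = (cnj (fst (stereo p)), - snd (stereo p))"
proof (cases p)
  case None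
  then show ?thesis by (simp add: stereo_def sphere_inverse_def)
next
  case (Some z)
  show ?thesis
  proof (cases "z = 0")
    case True
    then show ?thesis by (simp add: Some stereo_def sphere_inverse_def)
  next
    case False
    define Z where "Z = (cmod z)\<^sup>2"
    have Z: "Z > 0" using False by (simp add: Z_def)
    have i: "inverse z = (1 / Z) *\<^sub>R cnj z"
      by (simp add: inverse_eq_divide Z_def complex_div_cnj[of 1 z] scaleR_conv_of_real)
    have n: "(cmod (inverse z))\<^sup>2 = 1 / Z"
      by (simp add: Z_def norm_inverse power_inverse flip: inverse_eq_divide)
    have "stereo (sphere_inverse p) =
       ((2 / (1 + 1 / Z)) *\<^sub>R ((1 / Z) *\<^sub>R cnj z), (1 / Z - 1) / (1 / Z + 1))"
      unfolding Some sphere_inverse_def stereo_def using False n i by simp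
    also have "\<dots> = ((2 / (1 + Z)) *\<^sub>R cnj z, - ((Z - 1) / (Z + 1)))"
    proof -
      have "(1 / Z - 1) / (1 / Z + 1) = (Z * (1 / Z - 1)) / (Z * (1 / Z + 1))"
        using Z by simp
      also have "\<dots> = (1 - Z) / (Z + 1)"
        using Z by (simp add: distrib_left right_diff_distrib add.commute)
      also have "\<dots> = - ((Z - 1) / (Z + 1))"
        by (simp add: minus_divide_left)
      finally have "(1 / Z - 1) / (1 / Z + 1) = - ((Z - 1) / (Z + 1))" .
      moreover have "2 / (1 + 1 / Z) * (1 / Z) = 2 / (1 + Z)"
        using Z by (simp add: field_simps)
      ultimately show ?thesis by simp
    qed
    also have "\<dots> = (cnj (fst (stereo p)), - snd (stereo p))"
      by (simp add: Some stereo_def Z_def)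
    finally show ?thesis .
  qed
qed

lemma spherical_dist_sphere_inverse:
  "spherical_dist (sphere_inverse p) (sphere_inverse q) = spherical_dist p q"
proof -
  have "cnj a \<bullet> cnj b = a \<bullet> b" for a b :: complex by (simp add: inner_complex_def)
  then show ?thesis by (simp add: spherical_dist_def stereo_sphere_inverse inner_prod_def)
qed

section \<open>Closure properties of normal families\<close>

lemma normal_family_onE:
  fixes s :: "nat \<Rightarrow> complex \<Rightarrow> riemann_sphere"
  assumes "normal_family_on U F" "range s \<subseteq> F"
  obtains r :: "nat \<Rightarrow> nat" and g where "strict_mono r"
    "\<And>K. compact K \<Longrightarrow> K \<subseteq> U \<Longrightarrow>
      uniform_limit K (\<lambda>n z. spherical_dist (s (r n) z) (g z)) (\<lambda>_. 0) sequentially"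
proof -
  from assms(1)[unfolded normal_family_on_def, rule_format, OF assms(2)]
  obtain r :: "nat \<Rightarrow> nat" and g where r: "strict_mono r"
    and g: "\<forall>K. compact K \<and> K \<subseteq> U \<longrightarrow>
      uniform_limit K (\<lambda>n z. spherical_dist (s (r n) z) (g z)) (\<lambda>_. 0) sequentially"
    by (elim exE conjE)
  show ?thesis by (rule that[OF r g[rule_format, OF conjI]])
qed

text \<open>The maps are total, so members of the two families are compared on \<open>V\<close>
  only; this matters when a map is recovered by inverting twice, which is valid only where it does
  not vanish.\<close>

lemma normal_family_on_mono:
  assumes "normal_family_on U F'" "V \<subseteq> U" "\<And>s. s \<in> F \<Longrightarrow> \<exists>s'\<in>F'. \<forall>z\<in>V. s z = s' z"
  shows "normal_family_on V F"
  unfolding normal_family_on_def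
proof (intro allI impI)
  fix s :: "nat \<Rightarrow> complex \<Rightarrow> riemann_sphere" assume "range s \<subseteq> F"
  then have "\<forall>n. \<exists>s'\<in>F'. \<forall>z\<in>V. s n z = s' z" using assms(3) by blast
  then obtain t where t: "\<And>n. t n \<in> F'" "\<And>n z. z \<in> V \<Longrightarrow> s n z = t n z" by metis
  then have "range t \<subseteq> F'" by blast
  then obtain r g where r: "strict_mono r"
    and g: "\<And>K. compact K \<Longrightarrow> K \<subseteq> U \<Longrightarrow>
      uniform_limit K (\<lambda>n z. spherical_dist (t (r n) z) (g z)) (\<lambda>_. 0) sequentially"
    by (rule normal_family_onE[OF assms(1)]) (rule that)
  have "uniform_limit K (\<lambda>n z. spherical_dist (s (r n) z) (g z)) (\<lambda>_. 0) sequentially"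
    if "compact K" "K \<subseteq> V" for K
  proof -
    have "uniform_limit K (\<lambda>n z. spherical_dist (t (r n) z) (g z)) (\<lambda>_. 0) sequentially"
      using g that assms(2) by blast
    moreover have "s (r n) z = t (r n) z" if "z \<in> K" for n z
      using t(2) that \<open>K \<subseteq> V\<close> by blast
    ultimately show ?thesis unfolding uniform_limit_iff by simp
  qed
  with r show "\<exists>r. strict_mono r \<and> (\<exists>g. \<forall>K. compact K \<and> K \<subseteq> V \<longrightarrow>
      uniform_limit K (\<lambda>n z. spherical_dist (s (r n) z) (g z)) (\<lambda>_. 0) sequentially)"
    by blast
qed

text \<open>One of the two families contains infinitely many terms of the sequence; enumerating
  their indices gives a subsequence inside that family.\<close>

lemma normal_family_on_Un:
  assumes "normal_family_on U F" "normal_family_on U G"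
  shows "normal_family_on U (F \<union> G)"
  unfolding normal_family_on_def
proof (intro allI impI)
  fix s :: "nat \<Rightarrow> complex \<Rightarrow> riemann_sphere" assume s: "range s \<subseteq> F \<union> G"
  have "infinite {n. s n \<in> F} \<or> infinite {n. s n \<in> G}"
  proof -
    have "{n. s n \<in> F} \<union> {n. s n \<in> G} = UNIV" using s by blast
    then show ?thesis by (metis finite_Un infinite_UNIV_nat)
  qed
  then obtain H where inf: "infinite {n. s n \<in> H}" and H: "normal_family_on U H"
    using assms by blast
  define q where "q = enumerate {n. s n \<in> H}"
  have q: "strict_mono q" unfolding q_def by (rule strict_mono_enumerate[OF inf])
  have "range (s \<circ> q) \<subseteq> H" unfolding q_def using enumerate_in_set[OF inf] by auto
  then obtain r g where r: "strict_mono r"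
    and g: "\<And>K. compact K \<Longrightarrow> K \<subseteq> U \<Longrightarrow>
      uniform_limit K (\<lambda>n z. spherical_dist ((s \<circ> q) (r n) z) (g z)) (\<lambda>_. 0) sequentially"
    by (rule normal_family_onE[OF H]) (rule that)
  have "strict_mono (q \<circ> r)" using q r by (rule strict_mono_o)
  with g show "\<exists>r. strict_mono r \<and> (\<exists>g. \<forall>K. compact K \<and> K \<subseteq> U \<longrightarrow>
      uniform_limit K (\<lambda>n z. spherical_dist (s (r n) z) (g z)) (\<lambda>_. 0) sequentially)"
    by (intro exI[of _ "q \<circ> r"]) auto
qed

lemma normal_family_on_sphere_inverse:
  assumes "normal_family_on U F"
  shows "normal_family_on U ((\<lambda>s z. sphere_inverse (s z)) ` F)"
  unfolding normal_family_on_def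
proof (intro allI impI)
  fix s :: "nat \<Rightarrow> complex \<Rightarrow> riemann_sphere"
  assume "range s \<subseteq> (\<lambda>s z. sphere_inverse (s z)) ` F"
  then have "\<forall>n. \<exists>t\<in>F. s n = (\<lambda>z. sphere_inverse (t z))" by blast
  then obtain t where t: "\<And>n. t n \<in> F" and s: "\<And>n. s n = (\<lambda>z. sphere_inverse (t n z))"
    by metis
  then have "range t \<subseteq> F" by blast
  then obtain r g where r: "strict_mono r"
    and g: "\<And>K. compact K \<Longrightarrow> K \<subseteq> U \<Longrightarrow>
      uniform_limit K (\<lambda>n z. spherical_dist (t (r n) z) (g z)) (\<lambda>_. 0) sequentially"
    by (rule normal_family_onE[OF assms]) (rule that)
  have "\<forall>K. compact K \<and> K \<subseteq> U \<longrightarrow>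
      uniform_limit K (\<lambda>n z. spherical_dist (s (r n) z) (sphere_inverse (g z))) (\<lambda>_. 0) sequentially"
    using g by (simp add: s spherical_dist_sphere_inverse)
  with r show "\<exists>r. strict_mono r \<and> (\<exists>g. \<forall>K. compact K \<and> K \<subseteq> U \<longrightarrow>
      uniform_limit K (\<lambda>n z. spherical_dist (s (r n) z) (g z)) (\<lambda>_. 0) sequentially)"
    by (intro exI[of _ r] conjI exI[of _ "\<lambda>z. sphere_inverse (g z)"])
qed

section \<open>Montel's tests: bounded families and omitted values\<close>

text \<open>Montel's theorem gives a subsequence converging uniformly on compact sets in the
  Euclidean sense, which implies spherical convergence to a finite limit.\<close>

lemma normal_family_on_bounded:
  assumes "open U" "\<And>h. h \<in> H \<Longrightarrow> h holomorphic_on U"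
    and "\<And>h z. h \<in> H \<Longrightarrow> z \<in> U \<Longrightarrow> cmod (h z) \<le> B"
  shows "normal_family_on U ((\<lambda>h z. Some (h z)) ` H)"
  unfolding normal_family_on_def
proof (intro allI impI)
  fix s :: "nat \<Rightarrow> complex \<Rightarrow> riemann_sphere"
  assume "range s \<subseteq> (\<lambda>h z. Some (h z)) ` H"
  then have "\<forall>n. \<exists>h\<in>H. s n = (\<lambda>z. Some (h z))" by blast
  then obtain h where h: "\<And>n. h n \<in> H" and s: "\<And>n. s n = (\<lambda>z. Some (h n z))"
    by metis
  have "range h \<subseteq> H" using h by blast
  moreover have "\<exists>B. \<forall>h\<in>H. \<forall>z\<in>K. cmod (h z) \<le> B" if "K \<subseteq> U" for K
    using assms(3) that by blast
  ultimately obtain g r where r: "strict_mono r"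
    and g: "\<And>K. compact K \<Longrightarrow> K \<subseteq> U \<Longrightarrow> uniform_limit K (h \<circ> r) g sequentially"
    using Montel[OF assms(1), of H h] assms(2) by metis
  have "\<forall>K. compact K \<and> K \<subseteq> U \<longrightarrow>
      uniform_limit K (\<lambda>n z. spherical_dist (s (r n) z) (Some (g z))) (\<lambda>_. 0) sequentially"
    using uniform_limit_spherical_dist g by (fastforce simp: s)
  with r show "\<exists>r. strict_mono r \<and> (\<exists>g. \<forall>K. compact K \<and> K \<subseteq> U \<longrightarrow>
      uniform_limit K (\<lambda>n z. spherical_dist (s (r n) z) (g z)) (\<lambda>_. 0) sequentially)"
    by (intro exI[of _ r] conjI exI[of _ "\<lambda>z. Some (g z)"])
qed

text \<open>Montel's test with omitted values \<open>0\<close>, \<open>a\<close>, \<open>\<infinity>\<close>. By Schottky, the members with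
  \<open>|h z| \<le> |a|\<close> and the reciprocals of the others are locally bounded, and inversion is a
  spherical isometry.\<close>

lemma fundamental_normality_test:
  assumes "open U" "z \<in> U" "a \<noteq> 0"
    and hol: "\<And>h. h \<in> H \<Longrightarrow> h holomorphic_on U"
    and omit: "\<And>h w. h \<in> H \<Longrightarrow> w \<in> U \<Longrightarrow> h w \<noteq> 0 \<and> h w \<noteq> a"
  obtains V where "open V" "z \<in> V" "V \<subseteq> U" "normal_family_on V ((\<lambda>h w. Some (h w)) ` H)"
proof -
  obtain d where d: "d > 0" "ball z d \<subseteq> U" using assms(1,2) openE by blast
  define S where "S = ball z d"
  have S: "open S" "connected S" "z \<in> S" "S \<subseteq> U" using d by (auto simp: S_def)
  define H1 H2 where "H1 = {h\<in>H. cmod (h z) \<le> cmod a}" and "H2 = {h\<in>H. cmod a \<le> cmod (h z)}"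
  have holS: "h holomorphic_on S" if "h \<in> H" for h
    using hol[OF that] S(4) holomorphic_on_subset by blast
  have om: "h w \<noteq> 0" "h w \<noteq> a" if "h \<in> H" "w \<in> S" for h w using omit that S(4) by blast+
  \<comment> \<open>Division by \<open>a\<close> moves the omitted value \<open>a\<close> to 1 and
    bounds the members of \<open>H1\<close> by 1 at \<open>z\<close>, as \<open>GPicard1\<close>
    requires.\<close>
  obtain B1 Z1 where Z1: "open Z1" "z \<in> Z1" "Z1 \<subseteq> S"
    and B1: "\<And>h w. h \<in> (\<lambda>h w. h w / a) ` H1 \<Longrightarrow> w \<in> Z1 \<Longrightarrow> cmod (h w) \<le> B1"
  proof (rule GPicard1[OF S(1-3) zero_less_one, of "(\<lambda>h w. h w / a) ` H1" "(\<lambda>h w. h w / a) ` H"])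
    show "(\<lambda>h w. h w / a) ` H1 \<subseteq> (\<lambda>h w. h w / a) ` H" by (auto simp: H1_def)
    show "h holomorphic_on S" if "h \<in> (\<lambda>h w. h w / a) ` H" for h
      using that holS \<open>a \<noteq> 0\<close> by (auto intro!: holomorphic_intros)
    show "h w \<noteq> 0 \<and> h w \<noteq> 1" if "h \<in> (\<lambda>h w. h w / a) ` H" "w \<in> S" for h w
      using that om \<open>a \<noteq> 0\<close> by auto
    show "cmod (h z) \<le> 1" if "h \<in> (\<lambda>h w. h w / a) ` H1" for h
      using that \<open>a \<noteq> 0\<close> by (auto simp: H1_def norm_divide)
  qed blast
  \<comment> \<open>The same for \<open>a / h\<close>: it omits 0 and 1 because \<open>h\<close> is
    finite and differs from \<open>a\<close>, and at \<open>z\<close> it is bounded by 1 for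
    \<open>h\<close> in \<open>H2\<close>.\<close>
  obtain B2 Z2 where Z2: "open Z2" "z \<in> Z2" "Z2 \<subseteq> S"
    and B2: "\<And>h w. h \<in> (\<lambda>h w. a / h w) ` H2 \<Longrightarrow> w \<in> Z2 \<Longrightarrow> cmod (h w) \<le> B2"
  proof (rule GPicard1[OF S(1-3) zero_less_one, of "(\<lambda>h w. a / h w) ` H2" "(\<lambda>h w. a / h w) ` H"])
    show "(\<lambda>h w. a / h w) ` H2 \<subseteq> (\<lambda>h w. a / h w) ` H" by (auto simp: H2_def)
    show "h holomorphic_on S" if "h \<in> (\<lambda>h w. a / h w) ` H" for h
      using that holS om by (auto intro!: holomorphic_intros)
    show "h w \<noteq> 0 \<and> h w \<noteq> 1" if "h \<in> (\<lambda>h w. a / h w) ` H" "w \<in> S" for h w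
      using that om \<open>a \<noteq> 0\<close> by force
    show "cmod (h z) \<le> 1" if "h \<in> (\<lambda>h w. a / h w) ` H2" for h
      using that \<open>a \<noteq> 0\<close> by (auto simp: H2_def norm_divide divide_simps)
  qed blast
  define V where "V = Z1 \<inter> Z2"
  have V: "open V" "z \<in> V" "V \<subseteq> S" using Z1 Z2 by (auto simp: V_def)
  have n1: "normal_family_on V ((\<lambda>h w. Some (h w)) ` H1)"
  proof (rule normal_family_on_bounded[where B = "B1 * cmod a", OF V(1)])
    show "h holomorphic_on V" if "h \<in> H1" for h
      using that holS V(3) holomorphic_on_subset unfolding H1_def by blast
    show "cmod (h w) \<le> B1 * cmod a" if "h \<in> H1" "w \<in> V" for h w
      using B1[of "\<lambda>w. h w / a" w] that \<open>a \<noteq> 0\<close> by (auto simp: V_def norm_divide divide_simps)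
  qed
  have "normal_family_on V ((\<lambda>h w. Some (h w)) ` (\<lambda>h w. inverse (h w)) ` H2)"
  proof (rule normal_family_on_bounded[where B = "B2 / cmod a", OF V(1)])
    show "h holomorphic_on V" if "h \<in> (\<lambda>h w. inverse (h w)) ` H2" for h
    proof -
      obtain k where k: "k \<in> H" "h = (\<lambda>w. inverse (k w))" using \<open>h \<in> _\<close> unfolding H2_def by blast
      have "k holomorphic_on V" using holS[OF k(1)] V(3) by (rule holomorphic_on_subset)
      then show ?thesis using k om V(3) by (auto intro!: holomorphic_intros)
    qed
    show "cmod (h w) \<le> B2 / cmod a" if "h \<in> (\<lambda>h w. inverse (h w)) ` H2" "w \<in> V" for h w
    proof -
      obtain k where k: "k \<in> H2" "h = (\<lambda>w. inverse (k w))" using \<open>h \<in> _\<close> by blast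
      show ?thesis
        using B2[of "\<lambda>w. a / k w" w] that k \<open>a \<noteq> 0\<close>
        by (auto simp: V_def norm_divide norm_inverse divide_simps mult.commute)
    qed
  qed
  then have n2: "normal_family_on V
     ((\<lambda>s w. sphere_inverse (s w)) ` (\<lambda>h w. Some (h w)) ` (\<lambda>h w. inverse (h w)) ` H2)"
    by (rule normal_family_on_sphere_inverse)
  have "normal_family_on V ((\<lambda>h w. Some (h w)) ` H)"
  proof (rule normal_family_on_mono[OF normal_family_on_Un[OF n1 n2] subset_refl])
    fix s assume "s \<in> (\<lambda>h w. Some (h w)) ` H"
    then obtain h where h: "h \<in> H" "s = (\<lambda>w. Some (h w))" by blast
    show "\<exists>s'\<in>(\<lambda>h w. Some (h w)) ` H1 \<union>
      (\<lambda>s w. sphere_inverse (s w)) ` (\<lambda>h w. Some (h w)) ` (\<lambda>h w. inverse (h w)) ` H2.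
      \<forall>z\<in>V. s z = s' z"
    proof (cases "h \<in> H1")
      case True
      then have "s \<in> (\<lambda>h w. Some (h w)) ` H1" using h(2) by blast
      then show ?thesis by (intro bexI[of _ s] UnI1) auto
    next
      case False
      then have "h \<in> H2" using h by (auto simp: H1_def H2_def)
      then have "(\<lambda>w. sphere_inverse (Some (inverse (h w)))) \<in>
        (\<lambda>s w. sphere_inverse (s w)) ` (\<lambda>h w. Some (h w)) ` (\<lambda>h w. inverse (h w)) ` H2"
        unfolding image_image by (rule imageI)
      \<comment> \<open>The two inversions cancel because \<open>h\<close> has no zero on
        \<open>V\<close>.\<close>
      moreover have "\<forall>w\<in>V. s w = sphere_inverse (Some (inverse (h w)))"
        using h om V(3) by (auto simp: sphere_inverse_def)
      ultimately show ?thesis by (intro bexI[OF _ UnI2])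
    qed
  qed
  with V S show ?thesis using that by blast
qed

section \<open>Propagation of bounds in normal families\<close>

text \<open>In this form the height on the sphere is visibly increasing in the modulus, so a gap
  between moduli becomes a gap between heights.\<close>

lemma snd_stereo_Some: "snd (stereo (Some z)) = 1 - 2 / ((cmod z)\<^sup>2 + 1)"
proof -
  have "(cmod z)\<^sup>2 + 1 \<noteq> 0" by (simp add: add_nonneg_eq_0_iff)
  then show ?thesis by (simp add: stereo_def field_simps)
qed

text \<open>If no ball worked, members of \<open>H\<close> would take values of modulus above
  \<open>2 * M\<close> and below \<open>M\<close> at points tending to \<open>x\<close>. Along a
  convergent subsequence both values approach the same point \<open>stereo (g x)\<close>, although
  their heights stay a fixed amount apart.\<close>

lemma normal_family_dichotomy:
  assumes "open U" "x \<in> U" "M > 0"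
    and normal: "normal_family_on U ((\<lambda>h z. Some (h z)) ` H)"
    and cont: "\<And>h. h \<in> H \<Longrightarrow> continuous_on U h"
  shows "\<exists>d>0. ball x d \<subseteq> U \<and> (\<forall>h\<in>H. (\<forall>z\<in>ball x d. cmod (h z) \<le> 2 * M) \<or>
      (\<forall>z\<in>ball x d. M \<le> cmod (h z)))"
proof (rule ccontr)
  assume no: "\<not> ?thesis"
  obtain e where e: "e > 0" "cball x e \<subseteq> U" using assms(1,2) open_contains_cball by blast
  have *: "\<exists>h\<in>H. \<exists>u\<in>ball x d. \<exists>v\<in>ball x d. cmod (h u) > 2 * M \<and> cmod (h v) < M"
    if "0 < d" "d \<le> e" for d
  proof -
    have "ball x d \<subseteq> U" using that e by (meson ball_subset_cball order_trans subset_ball)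
    then show ?thesis using no \<open>0 < d\<close> by (meson not_le)
  qed
  have "\<exists>h u v. h \<in> H \<and> u \<in> ball x (e / Suc n) \<and> v \<in> ball x (e / Suc n) \<and>
      cmod (h u) > 2 * M \<and> cmod (h v) < M" for n
  proof -
    have "0 < e / Suc n" "e / Suc n \<le> e" using e(1) by (simp_all add: field_simps)
    from *[OF this] show ?thesis by blast
  qed
  then obtain h u v where h: "\<And>n. h n \<in> H"
    and u: "\<And>n. u n \<in> ball x (e / Suc n)" and v: "\<And>n. v n \<in> ball x (e / Suc n)"
    and hu: "\<And>n. cmod (h n (u n)) > 2 * M" and hv: "\<And>n. cmod (h n (v n)) < M"
    by metis
  have "range (\<lambda>n z. Some (h n z)) \<subseteq> (\<lambda>h z. Some (h z)) ` H" using h by blast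
  then obtain r g where r: "strict_mono r"
    and g: "\<And>K. compact K \<Longrightarrow> K \<subseteq> U \<Longrightarrow>
      uniform_limit K (\<lambda>n z. spherical_dist (Some (h (r n) z)) (g z)) (\<lambda>_. 0) sequentially"
    by (rule normal_family_onE[OF normal]) (rule that)
  have lim: "uniform_limit (cball x e)
      (\<lambda>n z. spherical_dist (Some (h (r n) z)) (g z)) (\<lambda>_. 0) sequentially"
    by (rule g[OF compact_cball e(2)])
  have ul: "uniform_limit (cball x e) (\<lambda>n z. stereo (Some (h (r n) z))) (\<lambda>z. stereo (g z)) sequentially"
  proof (rule uniform_limitI)
    fix \<epsilon> :: real assume "\<epsilon> > 0"
    from uniform_limitD[OF lim this]
    show "\<forall>\<^sub>F n in sequentially. \<forall>z\<in>cball x e. dist (stereo (Some (h (r n) z))) (stereo (g z)) < \<epsilon>"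
      by eventually_elim
        (use dist_stereo_le spherical_dist_nonneg in \<open>fastforce intro: le_less_trans\<close>)
  qed
  have c: "continuous_on (cball x e) (\<lambda>z. stereo (Some (h n z)))" for n
  proof -
    have "continuous_on (cball x e) (h n)"
      using cont[OF h] e(2) continuous_on_subset by blast
    moreover have "1 + (cmod w)\<^sup>2 \<noteq> 0" "(cmod w)\<^sup>2 + 1 \<noteq> 0" for w
      by (simp_all add: add_nonneg_eq_0_iff)
    ultimately show ?thesis by (auto simp: stereo_def intro!: continuous_intros)
  qed
  \<comment> \<open>The limit \<open>g\<close> comes as an arbitrary function; its continuity into
    the sphere follows from uniform convergence.\<close>
  have cg: "continuous_on (cball x e) (\<lambda>z. stereo (g z))"
    by (rule uniform_limit_theorem[OF _ ul]) (auto simp: c)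
  \<comment> \<open>A quarter of the height gap between the moduli \<open>M\<close> and
    \<open>2 * M\<close>. Each of the two values is within \<open>2 * \<eta>\<close> of
    \<open>stereo (g x)\<close>: one \<open>\<eta>\<close> for the convergence, one for the
    continuity of the limit.\<close>
  define \<eta> where "\<eta> = (2 / (M\<^sup>2 + 1) - 2 / ((2 * M)\<^sup>2 + 1)) / 4"
  have "\<eta> > 0" unfolding \<eta>_def using \<open>M > 0\<close>
    by (simp add: frac_less2 add_nonneg_pos power2_eq_square)
  have xe: "x \<in> cball x e" using e(1) by simp
  obtain d where d: "d > 0"
    "\<And>z. z \<in> cball x e \<Longrightarrow> dist z x < d \<Longrightarrow> dist (stereo (g z)) (stereo (g x)) < \<eta>"
    using cg xe \<open>\<eta> > 0\<close> unfolding continuous_on_iff by metis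
  have "\<forall>\<^sub>F n in sequentially. e / Suc n < d"
    by (rule order_tendstoD[OF LIMSEQ_Suc[OF lim_const_over_n]]) (rule d(1))
  then have "\<forall>\<^sub>F n in sequentially. e / Suc (r n) < d"
    using eventually_subseq[OF r] by simp
  with uniform_limitD[OF ul \<open>\<eta> > 0\<close>]
  have "\<forall>\<^sub>F n in sequentially. False"
  proof eventually_elim
    case (elim n)
    have *: "dist (stereo (Some (h (r n) z))) (stereo (g x)) < 2 * \<eta>"
      if "z \<in> ball x (e / Suc (r n))" for z
    proof -
      have "dist z x < e / Suc (r n)" using that by (simp add: dist_commute)
      moreover have "e / Suc (r n) \<le> e" using e(1) by (simp add: field_simps)
      ultimately have "z \<in> cball x e" "dist z x < d"
        using elim by (auto simp: dist_commute)
      with d(2)[of z] elim have "dist (stereo (g z)) (stereo (g x)) < \<eta>"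
        "dist (stereo (Some (h (r n) z))) (stereo (g z)) < \<eta>" by auto
      then show ?thesis
        using dist_triangle[of "stereo (Some (h (r n) z))" "stereo (g x)" "stereo (g z)"] by linarith
    qed
    let ?a = "stereo (Some (h (r n) (u (r n))))" and ?b = "stereo (Some (h (r n) (v (r n))))"
    have "dist ?a ?b < 4 * \<eta>"
      using *[OF u] *[OF v] dist_triangle2[of ?a ?b "stereo (g x)"] by linarith
    then have "snd ?a - snd ?b < 4 * \<eta>"
      using dist_snd_le[of ?a ?b] by (simp add: dist_real_def)
    moreover have "2 / ((cmod (h (r n) (u (r n))))\<^sup>2 + 1) \<le> 2 / ((2 * M)\<^sup>2 + 1)"
      using hu[of "r n"] \<open>M > 0\<close>
      by (intro divide_left_mono add_right_mono power_mono) (auto intro!: mult_pos_pos add_nonneg_pos)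
    moreover have "2 / (M\<^sup>2 + 1) \<le> 2 / ((cmod (h (r n) (v (r n))))\<^sup>2 + 1)"
      using hv[of "r n"] \<open>M > 0\<close>
      by (intro divide_left_mono add_right_mono power_mono) (auto intro!: mult_pos_pos add_nonneg_pos)
    ultimately show False unfolding snd_stereo_Some \<eta>_def by simp
  qed
  then show False by simp
qed

text \<open>Schottky's theorem on the unit disc, moved to \<open>cball w r\<close> by an affine map
  and taken at relative radius \<open>1 / 2\<close>; the term \<open>12 * t / (1 - t)\<close> is
  then 12, whence the 14.\<close>

lemma Schottky_ball:
  assumes "h holomorphic_on cball w r" "r > 0" "\<And>z. z \<in> cball w r \<Longrightarrow> h z \<noteq> 0 \<and> h z \<noteq> 1"
    "cmod (h w) \<le> B" "dist w z \<le> r / 2"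
  shows "cmod (h z) \<le> exp (pi * exp (pi * (14 + 2 * B)))"
proof -
  have im: "(\<lambda>\<zeta>. w + of_real r * \<zeta>) ` cball 0 1 \<subseteq> cball w r"
    using assms(2) by (auto simp: dist_norm norm_mult mult_left_le)
  have "cmod ((h \<circ> (\<lambda>\<zeta>. w + of_real r * \<zeta>)) ((z - w) / of_real r))
     \<le> exp (pi * exp (pi * (2 + 2 * B + 12 * (1 / 2) / (1 - 1 / 2))))"
  proof (rule Schottky[where f = "h \<circ> (\<lambda>\<zeta>. w + of_real r * \<zeta>)" and t = "1 / 2"])
    show "h \<circ> (\<lambda>\<zeta>. w + of_real r * \<zeta>) holomorphic_on cball 0 1"
      by (rule holomorphic_on_compose_gen[OF _ assms(1) im]) (intro holomorphic_intros)
    show "cmod ((z - w) / of_real r) \<le> 1 / 2"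
      using assms(2,5) by (simp add: norm_divide dist_norm norm_minus_commute field_simps)
    show "\<not> ((h \<circ> (\<lambda>\<zeta>. w + of_real r * \<zeta>)) z = 0 \<or> (h \<circ> (\<lambda>\<zeta>. w + of_real r * \<zeta>)) z = 1)"
      if "z \<in> cball 0 1" for z
      using assms(3) im that by (metis comp_apply image_subset_iff)
  qed (use assms in auto)
  moreover have "w + of_real r * ((z - w) / of_real r) = z" using assms(2) by simp
  ultimately show ?thesis by (simp add: algebra_simps)
qed

text \<open>The set of points of local boundedness is closed: where \<open>|h| \<ge> 2\<close> throughout a ball, \<open>h\<close> omits
  \<open>0\<close> and \<open>1\<close>, so Schottky's theorem carries a bound from one point to a ball around it.\<close>

lemma normal_family_locally_bounded:
  assumes "open S" "connected S" "p \<in> S"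
    and hol: "\<And>h. h \<in> H \<Longrightarrow> h holomorphic_on S"
    and normal: "\<And>x. x \<in> S \<Longrightarrow>
      \<exists>U. open U \<and> x \<in> U \<and> U \<subseteq> S \<and> normal_family_on U ((\<lambda>h z. Some (h z)) ` H)"
    and bdd: "\<And>h. h \<in> H \<Longrightarrow> cmod (h p) \<le> C"
    and K: "compact K" "K \<subseteq> S"
  shows "\<exists>B. \<forall>h\<in>H. \<forall>z\<in>K. cmod (h z) \<le> B"
proof -
  define A where "A = {x\<in>S. \<exists>V B. open V \<and> x \<in> V \<and> V \<subseteq> S \<and> (\<forall>h\<in>H. \<forall>z\<in>V. cmod (h z) \<le> B)}"
  have dich: "\<exists>d>0. ball x d \<subseteq> S \<and> (\<forall>h\<in>H. (\<forall>z\<in>ball x d. cmod (h z) \<le> 2 * M) \<or>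
      (\<forall>z\<in>ball x d. M \<le> cmod (h z)))" if x: "x \<in> S" and M: "M > 0" for x M
  proof -
    obtain U where U: "open U" "x \<in> U" "U \<subseteq> S" "normal_family_on U ((\<lambda>h z. Some (h z)) ` H)"
      using normal[OF x] by blast
    have cont: "continuous_on U h" if "h \<in> H" for h
      using hol[OF that] U(3) holomorphic_on_imp_continuous_on continuous_on_subset by blast
    obtain d where d: "d > 0" "ball x d \<subseteq> U" "\<forall>h\<in>H.
       (\<forall>z\<in>ball x d. cmod (h z) \<le> 2 * M) \<or> (\<forall>z\<in>ball x d. M \<le> cmod (h z))"
      using normal_family_dichotomy[OF U(1,2) M U(4), OF cont] by auto
    show ?thesis
      by (rule exI[of _ d]) (intro conjI d order_trans[OF d(2) U(3)])
  qed
  \<comment> \<open>A connectedness argument: \<open>A\<close> is non-empty, open, and contains its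
    limit points in \<open>S\<close>.\<close>
  have "A = S"
  proof (rule GPicard2[OF _ assms(2)])
    show "A \<subseteq> S" by (auto simp: A_def)
    show "A \<noteq> {}"
    proof -
      \<comment> \<open>Positive and above \<open>C\<close>, so the bound at \<open>p\<close> rules
        out the alternative \<open>M \<le> cmod (h z)\<close> on the whole ball.\<close>
      define M where "M = \<bar>C\<bar> + 1"
      have "M > 0" "M > C" by (auto simp: M_def)
      obtain d where d: "d > 0" "ball p d \<subseteq> S" "\<And>h. h \<in> H \<Longrightarrow>
         (\<forall>z\<in>ball p d. cmod (h z) \<le> 2 * M) \<or> (\<forall>z\<in>ball p d. M \<le> cmod (h z))"
        using dich[OF assms(3) \<open>M > 0\<close>] by blast
      have "cmod (h z) \<le> 2 * M" if "h \<in> H" "z \<in> ball p d" for h z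
      proof -
        have "\<not> (\<forall>z\<in>ball p d. M \<le> cmod (h z))"
          using bdd[OF that(1)] \<open>M > C\<close> d(1) by (metis centre_in_ball leD order_le_less_trans)
        with d(3)[OF that(1)] that(2) show ?thesis by blast
      qed
      then have "p \<in> A" unfolding A_def using assms(3) d(1,2)
        by (intro CollectI conjI exI[of _ "ball p d"] exI[of _ "2 * M"]) auto
      then show ?thesis by blast
    qed
    show "open A"
      unfolding open_subopen[of A]
    proof (intro ballI)
      fix x assume "x \<in> A"
      then obtain V B where "open V" "x \<in> V" "V \<subseteq> S" "\<forall>h\<in>H. \<forall>z\<in>V. cmod (h z) \<le> B"
        unfolding A_def by blast
      then show "\<exists>T. open T \<and> x \<in> T \<and> T \<subseteq> A"
        unfolding A_def by (intro exI[of _ V]) blast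
    qed
    show "x \<in> A" if xl: "x islimpt A" and xS: "x \<in> S" for x
    proof -
      obtain d where d: "d > 0" "ball x d \<subseteq> S" "\<And>h. h \<in> H \<Longrightarrow>
         (\<forall>z\<in>ball x d. cmod (h z) \<le> 2 * 2) \<or> (\<forall>z\<in>ball x d. 2 \<le> cmod (h z))"
        using dich[OF xS, of 2] by auto
      \<comment> \<open>With \<open>w\<close> this close to \<open>x\<close>, the ball
        \<open>cball w (d / 2)\<close> stays inside \<open>ball x d\<close>, while
        \<open>ball w (d / 4)\<close> still contains \<open>x\<close>.\<close>
      obtain w where w: "w \<in> A" "dist w x < d / 4"
        using xl d(1) unfolding islimpt_approachable by (metis zero_less_divide_iff zero_less_numeral)
      obtain B where B: "\<And>h. h \<in> H \<Longrightarrow> cmod (h w) \<le> B"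
        using w(1) unfolding A_def by blast
      have sub: "cball w (d / 2) \<subseteq> ball x d"
      proof
        fix y assume "y \<in> cball w (d / 2)"
        then show "y \<in> ball x d"
          using w(2) d(1) dist_triangle[of x y w] by (simp add: dist_commute)
      qed
      \<comment> \<open>The 4 serves the members bounded by \<open>2 * 2\<close> on the ball, the
        exponential those of modulus at least 2 there.\<close>
      define E where "E = max 4 (exp (pi * exp (pi * (14 + 2 * B))))"
      have E: "cmod (h z) \<le> E" if "h \<in> H" "z \<in> ball w (d / 4)" for h z
        using d(3)[OF that(1)]
      proof
        assume "\<forall>z\<in>ball x d. cmod (h z) \<le> 2 * 2"
        moreover have "z \<in> cball w (d / 2)" using that(2) d(1) by simp
        ultimately show ?thesis using sub unfolding E_def by fastforce
      next
        assume ge: "\<forall>z\<in>ball x d. 2 \<le> cmod (h z)"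
        have "cmod (h z) \<le> exp (pi * exp (pi * (14 + 2 * B)))"
        proof (rule Schottky_ball[where h = h and w = w and r = "d / 2"])
          show "h holomorphic_on cball w (d / 2)"
            using hol[OF that(1)] sub d(2) holomorphic_on_subset by blast
          show "h y \<noteq> 0 \<and> h y \<noteq> 1" if "y \<in> cball w (d / 2)" for y
            using ge sub that by force
        qed (use d(1) B that in auto)
        then show ?thesis by (simp add: E_def)
      qed
      have "ball w (d / 4) \<subseteq> S" "x \<in> ball w (d / 4)"
        using sub d(1,2) w(2) subset_ball[of "d/4" "d/2" w] by (auto dest!: subsetD)
      with E xS show "x \<in> A"
        unfolding A_def by (intro CollectI conjI exI[of _ "ball w (d / 4)"] exI[of _ E]) auto
    qed
  qed
  with K(2) have "K \<subseteq> A" by simp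
  have "\<forall>x\<in>K. \<exists>V B. open V \<and> x \<in> V \<and> (\<forall>h\<in>H. \<forall>z\<in>V. cmod (h z) \<le> B)"
  proof
    fix x assume "x \<in> K"
    with \<open>K \<subseteq> A\<close> have "x \<in> A" by (rule subsetD)
    then show "\<exists>V B. open V \<and> x \<in> V \<and> (\<forall>h\<in>H. \<forall>z\<in>V. cmod (h z) \<le> B)"
      unfolding A_def mem_Collect_eq by (elim conjE exE) (intro exI conjI)
  qed
  then obtain V B where V: "\<And>x. x \<in> K \<Longrightarrow> open (V x)" "\<And>x. x \<in> K \<Longrightarrow> x \<in> V x"
    and B: "\<And>x h z. x \<in> K \<Longrightarrow> h \<in> H \<Longrightarrow> z \<in> V x \<Longrightarrow> cmod (h z) \<le> B x"
    by metis
  have "K \<subseteq> \<Union> (V ` K)" using V(2) by blast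
  with K(1) V(1) obtain F where F: "F \<subseteq> K" "finite F" "K \<subseteq> \<Union> (V ` F)"
    using compactE_image[of K K V] by metis
  have "cmod (h z) \<le> (\<Sum>x\<in>F. \<bar>B x\<bar>)" if hH: "h \<in> H" and zK: "z \<in> K" for h z
  proof -
    obtain x where x: "x \<in> F" "z \<in> V x" using F(3) zK by blast
    then have "cmod (h z) \<le> \<bar>B x\<bar>" using B[of x h z] F(1) hH by fastforce
    also have "\<dots> \<le> (\<Sum>x\<in>F. \<bar>B x\<bar>)" using F(2) x(1) by (intro member_le_sum) auto
    finally show ?thesis .
  qed
  then show ?thesis by blast
qed

section \<open>Consequences of the great Picard theorem\<close>

text \<open>A reciprocal tending to 0 means a pole, one tending to another value means a finite
  limit. It rules out a limit of \<open>inverse \<circ> h\<close> at an essential singularity, as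
  Picard's theorem requires.\<close>

lemma not_essential_of_inverse_tendsto:
  fixes h :: "complex \<Rightarrow> complex"
  assumes "((inverse \<circ> h) \<longlongrightarrow> l) (at z)" "\<forall>\<^sub>F w in at z. h w \<noteq> 0"
  shows "not_essential h z"
proof (cases "l = 0")
  case True
  have "filterlim (\<lambda>w. inverse (h w)) (at 0) (at z)"
    using assms True by (auto simp: filterlim_at o_def elim: eventually_mono)
  then show ?thesis
    unfolding not_essential_def is_pole_def filterlim_inverse_at_iff by blast
next
  case False
  have "((\<lambda>w. inverse ((inverse \<circ> h) w)) \<longlongrightarrow> inverse l) (at z)"
    using assms(1) False by (rule tendsto_inverse)
  then show ?thesis unfolding not_essential_def by (auto simp: o_def)
qed

text \<open>Picard allows at most one value with a finite fibre. The value 0 has an empty fibre, so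
  it is the exceptional one.\<close>

lemma essential_nonvanishing_infinite_fibres:
  assumes "h holomorphic_on punctured_plane" "essential_singularity_at h 0"
    and "\<And>z. z \<in> punctured_plane \<Longrightarrow> h z \<noteq> 0" "a \<noteq> 0"
  shows "infinite {z \<in> punctured_plane. h z = a}"
proof -
  have ne: "\<not> not_essential h 0" using assms(2) by (simp add: essential_singularity_at_def)
  have "\<forall>\<^sub>F w in at 0. h w \<noteq> 0"
    using assms(3) by (auto simp: eventually_at_filter punctured_plane_def)
  then have "\<not> ((inverse \<circ> h) \<longlongrightarrow> l) (at 0)" for l
    using ne not_essential_of_inverse_tendsto by blast
  moreover have "\<not> (h \<longlongrightarrow> l) (at 0)" for l
    using ne unfolding not_essential_def by blast
  moreover have "h holomorphic_on UNIV - {0}" using assms(1) by (simp add: punctured_plane_def)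
  ultimately obtain c where c: "\<And>w. w \<noteq> c \<Longrightarrow> infinite {x. x \<in> UNIV - {0} \<and> h x = w}"
    using great_Picard_infinite[of UNIV 0 h] by auto
  have "{x. x \<in> UNIV - {0} \<and> h x = 0} = {}"
    using assms(3) by (auto simp: punctured_plane_def)
  then have "c = 0" using c[of 0] by (metis finite.emptyI)
  then show ?thesis using c[of a] \<open>a \<noteq> 0\<close> by (simp add: punctured_plane_def)
qed

lemma open_punctured_plane: "open punctured_plane"
  and connected_punctured_plane: "connected punctured_plane"
  using connected_punctured_universe[of "0::complex"]
  by (auto simp: punctured_plane_def Compl_eq_Diff_UNIV)

lemma transcendental_infinite_fibres:
  assumes "transcendental_self_map f" "a \<noteq> 0"
  shows "infinite {z \<in> punctured_plane. f z = a}"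
proof (rule essential_nonvanishing_infinite_fibres[OF _ _ _ assms(2)])
  show "f z \<noteq> 0" if "z \<in> punctured_plane" for z
    using assms(1) that unfolding transcendental_self_map_def punctured_plane_def by blast
qed (use assms in \<open>auto simp: transcendental_self_map_def\<close>)

text \<open>Fixed points of \<open>f\<close> are the solutions of \<open>f z / z = 1\<close>. The
  quotient has no zeros, and it is essential at 0, since multiplying back by \<open>z\<close> would
  otherwise make \<open>f\<close> inessential.\<close>

lemma transcendental_infinite_fixed_points:
  assumes "transcendental_self_map f"
  shows "infinite {z \<in> punctured_plane. f z = z}"
proof -
  have f: "f holomorphic_on punctured_plane" "f ` punctured_plane \<subseteq> punctured_plane"
    "\<not> not_essential f 0"
    using assms by (auto simp: transcendental_self_map_def essential_singularity_at_def)
  have hol: "(\<lambda>z. f z / z) holomorphic_on punctured_plane"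
    by (intro holomorphic_intros f(1)) (auto simp: punctured_plane_def)
  then have iso: "isolated_singularity_at (\<lambda>z. f z / z) 0"
    by (intro isolated_singularity_at_holomorphic[of _ UNIV]) (auto simp: punctured_plane_def)
  have "\<not> not_essential (\<lambda>z. f z / z) 0"
  proof
    assume "not_essential (\<lambda>z. f z / z) 0"
    then have "not_essential (\<lambda>z. f z / z * z) 0"
      using iso by (intro not_essential_times)
        (auto simp: not_essential_def intro!: singularity_intros tendsto_intros)
    moreover have "not_essential (\<lambda>z. f z / z * z) 0 = not_essential f 0"
      by (rule not_essential_cong) (simp_all add: eventually_at_filter)
    ultimately show False using f(3) by blast
  qed
  then have "infinite {z \<in> punctured_plane. f z / z = 1}"
    using f(2) hol iso
    by (intro essential_nonvanishing_infinite_fibres)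
      (auto simp: essential_singularity_at_def punctured_plane_def)
  moreover have "{z \<in> punctured_plane. f z / z = 1} = {z \<in> punctured_plane. f z = z}"
    by (auto simp: punctured_plane_def)
  ultimately show ?thesis by simp
qed

section \<open>Iterates and forward invariance of the Fatou set\<close>

lemma funpow_in_punctured_plane:
  assumes "f ` punctured_plane \<subseteq> punctured_plane" "z \<in> punctured_plane"
  shows "(f ^^ k) z \<in> punctured_plane"
  using assms by (induction k) auto

lemma funpow_holomorphic_punctured_plane:
  assumes "f holomorphic_on punctured_plane" "f ` punctured_plane \<subseteq> punctured_plane"
  shows "(f ^^ k) holomorphic_on punctured_plane"
proof (induction k)
  case 0
  then show ?case by (simp add: id_def)
next
  case (Suc k)
  have "(f ^^ k) ` punctured_plane \<subseteq> punctured_plane"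
    using funpow_in_punctured_plane[OF assms(2)] by blast
  then show ?case using holomorphic_on_compose_gen[OF Suc assms(1)] by (simp add: o_def)
qed

text \<open>The image of a small ball is open, and the \<open>k\<close>-th iterate at
  \<open>f v\<close> is the iterate of order \<open>Suc k\<close> at \<open>v\<close>. Normality
  near \<open>z\<close> thus passes to the image, with limits read off at chosen preimages.\<close>

lemma fatou_set_forward_invariant:
  assumes f: "transcendental_self_map f" and z: "z \<in> fatou_set f"
  shows "f z \<in> fatou_set f"
proof -
  have hol: "f holomorphic_on punctured_plane" and im: "f ` punctured_plane \<subseteq> punctured_plane"
    using f by (auto simp: transcendental_self_map_def)
  obtain U where U: "open U" "z \<in> U" "U \<subseteq> punctured_plane"
    and normal: "normal_family_on U {(\<lambda>w. Some ((f ^^ k) w)) | k. k \<ge> 1}"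
    using z unfolding fatou_set_def by blast
  obtain e where e: "e > 0" "cball z e \<subseteq> U" using U(1,2) open_contains_cball by blast
  define V where "V = f ` ball z e"
  have ncon: "\<not> f constant_on punctured_plane"
  proof
    assume "f constant_on punctured_plane"
    then obtain c where c: "\<And>w. w \<in> punctured_plane \<Longrightarrow> f w = c" by (auto simp: constant_on_def)
    obtain a where a: "a \<noteq> 0" "a \<noteq> c"
      using ex_new_if_finite[OF infinite_UNIV_char_0, of "{0, c}"] by auto
    have "{w \<in> punctured_plane. f w = a} = {}" using a c by auto
    then show False using transcendental_infinite_fibres[OF f a(1)] by (metis finite.emptyI)
  qed
  have be: "ball z e \<subseteq> punctured_plane" using e(2) U(3) ball_subset_cball by blast
  have "open V" unfolding V_def
    by (rule open_mapping_thm[OF hol open_punctured_plane connected_punctured_plane open_ball be ncon])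
  moreover have "f z \<in> V" using e(1) by (auto simp: V_def)
  moreover have "V \<subseteq> punctured_plane" using be im unfolding V_def by blast
  moreover have "normal_family_on V {(\<lambda>w. Some ((f ^^ k) w)) | k. k \<ge> 1}"
    unfolding normal_family_on_def
  proof (intro allI impI)
    fix s :: "nat \<Rightarrow> complex \<Rightarrow> riemann_sphere"
    assume "range s \<subseteq> {(\<lambda>w. Some ((f ^^ k) w)) | k. k \<ge> 1}"
    then have "\<forall>n. \<exists>k. s n = (\<lambda>w. Some ((f ^^ k) w))" by blast
    then obtain k where k: "\<And>n. s n = (\<lambda>w. Some ((f ^^ k n) w))" by metis
    have "range (\<lambda>n w. Some ((f ^^ Suc (k n)) w)) \<subseteq> {(\<lambda>w. Some ((f ^^ k) w)) | k. k \<ge> 1}"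
      by fastforce
    then obtain r g where r: "strict_mono r" and g: "\<And>K. compact K \<Longrightarrow> K \<subseteq> U \<Longrightarrow>
      uniform_limit K (\<lambda>n w. spherical_dist (Some ((f ^^ Suc (k (r n))) w)) (g w)) (\<lambda>_. 0) sequentially"
      by (rule normal_family_onE[OF normal]) (rule that)
    have "\<forall>w\<in>V. \<exists>v\<in>cball z e. f v = w" unfolding V_def by auto
    \<comment> \<open>All preimages are chosen in one compact ball, so uniformity over that ball
      yields uniformity over every subset of \<open>V\<close>.\<close>
    then obtain q where q: "\<And>w. w \<in> V \<Longrightarrow> q w \<in> cball z e" "\<And>w. w \<in> V \<Longrightarrow> f (q w) = w"
      by metis
    have "uniform_limit K (\<lambda>n w. spherical_dist (s (r n) w) (g (q w))) (\<lambda>_. 0) sequentially"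
      if "K \<subseteq> V" for K
    proof (rule uniform_limitI)
      fix \<epsilon> :: real assume "\<epsilon> > 0"
      from uniform_limitD[OF g[OF compact_cball e(2)] this]
      show "\<forall>\<^sub>F n in sequentially. \<forall>w\<in>K. dist (spherical_dist (s (r n) w) (g (q w))) 0 < \<epsilon>"
      proof (eventually_elim, intro ballI)
        fix n w
        assume *: "\<forall>v\<in>cball z e.
          dist (spherical_dist (Some ((f ^^ Suc (k (r n))) v)) (g v)) 0 < \<epsilon>" "w \<in> K"
        then have w: "w \<in> V" using that by blast
        have "(f ^^ Suc (k (r n))) (q w) = (f ^^ k (r n)) w"
          using q(2)[OF w] by (simp add: funpow_swap1)
        then show "dist (spherical_dist (s (r n) w) (g (q w))) 0 < \<epsilon>"
          using *(1) q(1)[OF w] unfolding k by metis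
      qed
    qed
    with r show "\<exists>r. strict_mono r \<and> (\<exists>g. \<forall>K. compact K \<and> K \<subseteq> V \<longrightarrow>
      uniform_limit K (\<lambda>n z. spherical_dist (s (r n) z) (g z)) (\<lambda>_. 0) sequentially)"
      by (intro exI[of _ r] conjI exI[of _ "\<lambda>w. g (q w)"]) auto
  qed
  ultimately show ?thesis unfolding fatou_set_def by blast
qed

section \<open>The Julia set is non-empty and infinite\<close>

text \<open>Locally uniform convergence of continuous maps may be evaluated along a convergent
  sequence of points. It identifies the limit of composed iterates below.\<close>

lemma tendsto_uniform_limit_compose:
  fixes F :: "nat \<Rightarrow> 'a::heine_borel \<Rightarrow> 'b::metric_space"
  assumes "open S" "y \<in> S" "\<And>n. continuous_on S (F n)"
    and ul: "\<And>K. compact K \<Longrightarrow> K \<subseteq> S \<Longrightarrow> uniform_limit K F h sequentially"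
    and "u \<longlonglongrightarrow> y"
  shows "(\<lambda>n. F n (u n)) \<longlonglongrightarrow> h y"
proof -
  obtain e where e: "e > 0" "cball y e \<subseteq> S" using assms(1,2) open_contains_cball by blast
  have ulc: "uniform_limit (cball y e) F h sequentially" by (rule ul[OF compact_cball e(2)])
  have "continuous_on (cball y e) (F n)" for n
    using assms(3) e(2) by (rule continuous_on_subset)
  then have "continuous_on (cball y e) h"
    by (intro uniform_limit_theorem[OF _ ulc]) (simp_all add: always_eventually)
  moreover have ev: "\<forall>\<^sub>F n in sequentially. u n \<in> cball y e"
    using tendstoD[OF assms(5) e(1)] by eventually_elim (simp add: dist_commute)
  ultimately have hu: "(\<lambda>n. h (u n)) \<longlonglongrightarrow> h y"
    using e(1) by (intro continuous_on_tendsto_compose[OF _ assms(5)]) auto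
  show ?thesis
  proof (rule tendstoI)
    fix \<epsilon> :: real assume "\<epsilon> > 0"
    then have "\<epsilon> / 2 > 0" by simp
    from uniform_limitD[OF ulc this] tendstoD[OF hu this] ev
    show "\<forall>\<^sub>F n in sequentially. dist (F n (u n)) (h y) < \<epsilon>"
    proof eventually_elim
      case (elim n)
      then show ?case
        using dist_triangle[of "F n (u n)" "h y" "h (u n)"] by fastforce
    qed
  qed
qed

lemma julia_set_nonempty:
  assumes f: "transcendental_self_map f"
  shows "julia_set f \<noteq> {}"
proof
  assume "julia_set f = {}"
  then have J: "\<And>z. z \<in> punctured_plane \<Longrightarrow> z \<in> fatou_set f" unfolding julia_set_def by blast
  let ?S = punctured_plane
  have hol: "f holomorphic_on ?S" and im: "f ` ?S \<subseteq> ?S"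
    using f by (auto simp: transcendental_self_map_def)
  define H where "H = {f ^^ k | k. k \<ge> 1}"
  have inH: "f ^^ k \<in> H" if "k \<ge> 1" for k using that by (auto simp: H_def)
  have holH: "h holomorphic_on ?S" if "h \<in> H" for h
    using that funpow_holomorphic_punctured_plane[OF hol im] unfolding H_def by blast
  have H_eq: "(\<lambda>h z. Some (h z)) ` H = {(\<lambda>w. Some ((f ^^ k) w)) | k. k \<ge> 1}"
    unfolding H_def by auto
  obtain p where p: "p \<in> ?S" "f p = p"
    using infinite_imp_nonempty[OF transcendental_infinite_fixed_points[OF f]] by blast
  have "{z \<in> ?S. f z = z} - {p} \<noteq> {}"
    by (rule infinite_imp_nonempty) (simp add: transcendental_infinite_fixed_points[OF f])
  \<comment> \<open>The fixed point \<open>p\<close> anchors the boundedness argument; a second one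
    is taken so that limits fixing both are not constant.\<close>
  then obtain q where q: "q \<in> ?S" "f q = q" "q \<noteq> p" by blast
  have fixp: "(f ^^ k) x = x" if "f x = x" for k x using that by (induction k) auto
  have bdd: "\<exists>B. \<forall>h\<in>H. \<forall>z\<in>K. cmod (h z) \<le> B" if "compact K" "K \<subseteq> ?S" for K
  proof (rule normal_family_locally_bounded[OF open_punctured_plane connected_punctured_plane p(1)])
    show "\<exists>U. open U \<and> x \<in> U \<and> U \<subseteq> ?S \<and> normal_family_on U ((\<lambda>h z. Some (h z)) ` H)"
      if "x \<in> ?S" for x
      using J[OF that] unfolding H_eq fatou_set_def by blast
    show "cmod (h p) \<le> cmod p" if "h \<in> H" for h
      using that fixp[OF p(2)] by (auto simp: H_def)
  qed (use holH that in auto)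
  have limit: "\<exists>g r. g holomorphic_on ?S \<and> strict_mono (r :: nat \<Rightarrow> nat) \<and>
      (\<forall>K. compact K \<longrightarrow> K \<subseteq> ?S \<longrightarrow> uniform_limit K (\<lambda>n. f ^^ k (r n)) g sequentially) \<and>
      (\<forall>x\<in>?S. (\<lambda>n. (f ^^ k (r n)) x) \<longlonglongrightarrow> g x)"
    if k: "\<And>n. k n \<ge> 1" for k :: "nat \<Rightarrow> nat"
  proof -
    have "range (\<lambda>n. f ^^ k n) \<subseteq> H" using inH k by auto
    from Montel[OF open_punctured_plane holH bdd this]
    obtain g r where "g holomorphic_on ?S" "strict_mono (r :: nat \<Rightarrow> nat)"
      "\<And>x. x \<in> ?S \<Longrightarrow> (\<lambda>n. (f ^^ k (r n)) x) \<longlonglongrightarrow> g x"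
      "\<And>K. compact K \<Longrightarrow> K \<subseteq> ?S \<Longrightarrow> uniform_limit K ((\<lambda>n. f ^^ k n) \<circ> r) g sequentially"
      by blast
    then show ?thesis by (intro exI[of _ g] exI[of _ r]) (auto simp: o_def)
  qed
  \<comment> \<open>\<open>Suc\<close> as the sequence of exponents keeps all of them at least 1;
    the exponents along the subsequence are \<open>Suc (r n)\<close>.\<close>
  obtain g r where g: "g holomorphic_on ?S" and r: "strict_mono (r :: nat \<Rightarrow> nat)"
    and gu: "\<And>K. compact K \<Longrightarrow> K \<subseteq> ?S \<Longrightarrow> uniform_limit K (\<lambda>n. f ^^ Suc (r n)) g sequentially"
    and gp: "\<And>x. x \<in> ?S \<Longrightarrow> (\<lambda>n. (f ^^ Suc (r n)) x) \<longlonglongrightarrow> g x"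
    using limit[of Suc] by auto
  have gfix: "g x = x" if "x \<in> ?S" "f x = x" for x
  proof (rule LIMSEQ_unique[OF gp[OF that(1)]])
    show "(\<lambda>n. (f ^^ Suc (r n)) x) \<longlonglongrightarrow> x" unfolding fixp[OF that(2)] by simp
  qed
  have gS: "g x \<in> ?S" if "x \<in> ?S" for x
  proof -
    \<comment> \<open>This excludes the case in Hurwitz's theorem where a limit of zero-free
      functions is identically 0.\<close>
    have "\<not> g constant_on ?S"
      using gfix[OF p] gfix[OF q(1,2)] p(1) q(1,3) unfolding constant_on_def by metis
    moreover have "(f ^^ Suc (r n)) holomorphic_on ?S" for n
      by (rule funpow_holomorphic_punctured_plane[OF hol im])
    moreover have "(f ^^ Suc (r n)) z \<noteq> 0" if "z \<in> ?S" for n z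
      using funpow_in_punctured_plane[OF im that] unfolding punctured_plane_def by blast
    ultimately have "g x \<noteq> 0"
      using Hurwitz_no_zeros[OF open_punctured_plane connected_punctured_plane, of "\<lambda>n. f ^^ Suc (r n)" g x]
        g gu that by blast
    then show ?thesis by (simp add: punctured_plane_def)
  qed
  define m where "m n = r (Suc n) - r n" for n
  have r_lt: "r n < r (Suc n)" for n using r by (simp add: strict_mono_Suc_iff)
  then have "m n \<ge> 1" for n unfolding m_def by (simp add: Suc_leI)
  then obtain h t where h: "h holomorphic_on ?S" and t: "strict_mono (t :: nat \<Rightarrow> nat)"
    and hu: "\<And>K. compact K \<Longrightarrow> K \<subseteq> ?S \<Longrightarrow> uniform_limit K (\<lambda>n. f ^^ m (t n)) h sequentially"
    and hp: "\<And>x. x \<in> ?S \<Longrightarrow> (\<lambda>n. (f ^^ m (t n)) x) \<longlonglongrightarrow> h x"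
    using limit[of m] by auto
  \<comment> \<open>The \<open>m (t n)\<close>-th iterate carries one iterate of the subsequence to
    the next. The same sequence therefore tends to \<open>h (g x)\<close>, by evaluation at moving
    points, and to \<open>g x\<close>, as a subsequence.\<close>
  have hg: "h (g x) = g x" if x: "x \<in> ?S" for x
  proof (rule LIMSEQ_unique)
    have "(\<lambda>n. (f ^^ Suc (r (t n))) x) \<longlonglongrightarrow> g x"
      using LIMSEQ_subseq_LIMSEQ[OF gp[OF x] t] by (simp add: o_def)
    then show "(\<lambda>n. (f ^^ m (t n)) ((f ^^ Suc (r (t n))) x)) \<longlonglongrightarrow> h (g x)"
      by (intro tendsto_uniform_limit_compose[OF open_punctured_plane gS[OF x] _ hu]
          holomorphic_on_imp_continuous_on funpow_holomorphic_punctured_plane[OF hol im])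
    have "(f ^^ m (t n)) ((f ^^ Suc (r (t n))) x) = (f ^^ Suc (r (Suc (t n)))) x" for n
    proof -
      have "Suc (r (Suc (t n))) = m (t n) + Suc (r (t n))"
        using r_lt[of "t n"] by (simp add: m_def)
      then show ?thesis by (metis comp_apply funpow_add)
    qed
    moreover have "strict_mono (\<lambda>n. Suc (t n))" using t by (simp add: strict_mono_def)
    ultimately show "(\<lambda>n. (f ^^ m (t n)) ((f ^^ Suc (r (t n))) x)) \<longlonglongrightarrow> g x"
      using LIMSEQ_subseq_LIMSEQ[OF gp[OF x]] by (fastforce simp: o_def)
  qed
  \<comment> \<open>A connected set with more than one point has no isolated points; here
    \<open>p\<close> and \<open>q\<close> both lie in the image. This supplies the accumulation
    point for the identity theorem.\<close>
  have "p islimpt g ` ?S"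
  proof (rule connected_imp_perfect)
    show "connected (g ` ?S)"
      by (rule connected_continuous_image[OF holomorphic_on_imp_continuous_on[OF g] connected_punctured_plane])
    show "p \<in> g ` ?S" using p gfix by force
    have "q \<in> g ` ?S" using q gfix by force
    then show "g ` ?S \<noteq> {x}" for x using \<open>p \<in> g ` ?S\<close> q(3) by (metis singletonD)
  qed
  then have h_id: "h x - x = 0" if "x \<in> ?S" for x
    using hg gS that p(1)
    by (intro analytic_continuation[of "\<lambda>x. h x - x" ?S "g ` ?S" p x, OF _ open_punctured_plane connected_punctured_plane])
      (auto intro!: holomorphic_intros h)
  have inj: "x = y" if "x \<in> ?S" "y \<in> ?S" "f x = f y" for x y
  proof -
    \<comment> \<open>Since \<open>m (t n) \<ge> 1\<close>, each of these iterates applies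
      \<open>f\<close> first, where \<open>x\<close> and \<open>y\<close> are already
      identified.\<close>
    have "(f ^^ m (t n)) x = (f ^^ m (t n)) y" for n
      using \<open>\<And>n. m n \<ge> 1\<close>[of "t n"] that(3) by (cases "m (t n)") (auto simp: funpow_Suc_right simp del: funpow.simps)
    then have "h x = h y"
      using hp[OF that(1)] hp[OF that(2)] LIMSEQ_unique by simp
    then show ?thesis using h_id[OF that(1)] h_id[OF that(2)] by simp
  qed
  have "{z \<in> ?S. f z = p} \<subseteq> {p}" using inj p by fastforce
  moreover have "infinite {z \<in> ?S. f z = p}"
    using transcendental_infinite_fibres[OF f] p(1) by (simp add: punctured_plane_def)
  ultimately show False using finite_subset by blast
qed

lemma julia_set_infinite:
  assumes f: "transcendental_self_map f"
  shows "infinite (julia_set f)"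
proof -
  obtain a where a: "a \<in> julia_set f" using julia_set_nonempty[OF f] by blast
  then have "a \<noteq> 0" by (simp add: julia_set_def punctured_plane_def)
  \<comment> \<open>Contrapositive of forward invariance: a Fatou preimage would make
    \<open>a\<close> a Fatou point.\<close>
  have "{z \<in> punctured_plane. f z = a} \<subseteq> julia_set f"
    using a fatou_set_forward_invariant[OF f] unfolding julia_set_def by blast
  then show ?thesis using transcendental_infinite_fibres[OF f \<open>a \<noteq> 0\<close>] finite_subset by blast
qed

section \<open>Orbits of neighbourhoods and the characterisation\<close>

text \<open>A missed point \<open>a\<close> would be omitted on \<open>U\<close> by every iterate,
  along with 0; the normality test then puts \<open>z\<close> in the Fatou set.\<close>

lemma julia_set_covers_punctured_plane:
  assumes f: "transcendental_self_map f" and z: "z \<in> julia_set f"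
    and U: "open U" "z \<in> U" "U \<subseteq> punctured_plane"
  shows "punctured_plane \<subseteq> forward_orbit f U"
proof (rule ccontr)
  assume "\<not> ?thesis"
  then obtain a where a: "a \<noteq> 0" "a \<notin> forward_orbit f U" by (auto simp: punctured_plane_def)
  have hol: "f holomorphic_on punctured_plane" and im: "f ` punctured_plane \<subseteq> punctured_plane"
    using f by (auto simp: transcendental_self_map_def)
  define H where "H = {f ^^ k | k. k \<ge> 1}"
  obtain V where V: "open V" "z \<in> V" "V \<subseteq> U" "normal_family_on V ((\<lambda>h w. Some (h w)) ` H)"
  proof (rule fundamental_normality_test[OF U(1,2) a(1)])
    show "h holomorphic_on U" if "h \<in> H" for h
      using that funpow_holomorphic_punctured_plane[OF hol im] U(3) holomorphic_on_subset
      unfolding H_def by blast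
    show "h w \<noteq> 0 \<and> h w \<noteq> a" if "h \<in> H" "w \<in> U" for h w
    proof -
      obtain k where k: "h = f ^^ k" "k \<ge> 1" using \<open>h \<in> H\<close> by (auto simp: H_def)
      have "h w \<in> punctured_plane"
        unfolding k using funpow_in_punctured_plane[OF im] U(3) \<open>w \<in> U\<close> by blast
      moreover have "h w \<in> forward_orbit f U"
        unfolding forward_orbit_def using k \<open>w \<in> U\<close> by auto
      ultimately show ?thesis using a(2) by (auto simp: punctured_plane_def)
    qed
  qed blast
  have "(\<lambda>h w. Some (h w)) ` H = {(\<lambda>w. Some ((f ^^ k) w)) | k. k \<ge> 1}"
    unfolding H_def by auto
  with V U(3) have "z \<in> fatou_set f" unfolding fatou_set_def by auto
  then show False using z by (simp add: julia_set_def)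
qed

lemma forward_orbit_subset_fatou_set:
  assumes "transcendental_self_map f" "U \<subseteq> fatou_set f"
  shows "forward_orbit f U \<subseteq> fatou_set f"
proof -
  have "(f ^^ k) z \<in> fatou_set f" if "z \<in> U" for k z
    using that assms(2) fatou_set_forward_invariant[OF assms(1)] by (induction k) auto
  then show ?thesis unfolding forward_orbit_def by blast
qed

theorem theorem1p1:
  fixes f :: "complex \<Rightarrow> complex"
  assumes "transcendental_self_map f"
  shows "julia_set f =
    {z \<in> punctured_plane. \<forall>U. open U \<and> z \<in> U \<and> U \<subseteq> punctured_plane \<longrightarrow>
       finite ((UNIV :: riemann_sphere set) - Some ` forward_orbit f U)}"
proof (intro set_eqI iffI)
  fix z assume z: "z \<in> julia_set f"
  have "finite ((UNIV :: riemann_sphere set) - Some ` forward_orbit f U)"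
    if "open U" "z \<in> U" "U \<subseteq> punctured_plane" for U
  proof (rule finite_subset)
    \<comment> \<open>Only infinity and 0 can be missed.\<close>
    show "UNIV - Some ` forward_orbit f U \<subseteq> {None, Some 0}"
    proof
      fix p assume p: "p \<in> UNIV - Some ` forward_orbit f U"
      then show "p \<in> {None, Some 0}"
        using julia_set_covers_punctured_plane[OF assms z that]
        by (cases p) (auto simp: punctured_plane_def)
    qed
  qed simp
  then show "z \<in> {z \<in> punctured_plane. \<forall>U. open U \<and> z \<in> U \<and> U \<subseteq> punctured_plane \<longrightarrow>
       finite ((UNIV :: riemann_sphere set) - Some ` forward_orbit f U)}"
    using z by (simp add: julia_set_def)
next
  fix z assume z: "z \<in> {z \<in> punctured_plane. \<forall>U. open U \<and> z \<in> U \<and> U \<subseteq> punctured_plane \<longrightarrow>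
       finite ((UNIV :: riemann_sphere set) - Some ` forward_orbit f U)}"
  show "z \<in> julia_set f"
  proof (rule ccontr)
    assume "z \<notin> julia_set f"
    then have "z \<in> fatou_set f" using z by (simp add: julia_set_def)
    then obtain U where U: "open U" "z \<in> U" "U \<subseteq> punctured_plane"
      "normal_family_on U {(\<lambda>w. Some ((f ^^ k) w)) | k. k \<ge> 1}"
      unfolding fatou_set_def by blast
    \<comment> \<open>The one open set \<open>U\<close> witnesses normality for each of its
      points.\<close>
    then have "U \<subseteq> fatou_set f" unfolding fatou_set_def by blast
    then have "Some ` julia_set f \<subseteq> UNIV - Some ` forward_orbit f U"
      using forward_orbit_subset_fatou_set[OF assms] unfolding julia_set_def by blast
    moreover have "infinite (Some ` julia_set f)"
      using julia_set_infinite[OF assms] by (simp add: finite_image_iff)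
    ultimately show False using z U(1-3) finite_subset by blast
  qed
qed

end
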